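(* Let $n,t,\lambda,s_1,s_2$ be positive integers with $\min\{s_1+1,s_2+1\}\le\lambda\le s_1+s_2$. Then \[m(n,t,\lambda;s_1+1,s_2+1)\ge\max\left\{\binom{n}{t}-\binom{n-\lceil\lambda/s_1\rceil+1}{t},\ \binom{n}{t}-\binom{n-\lceil\lambda/s_2\rceil+1}{n-t}\right\}.\]
   Context: $[m]=\{1,\dots,m\}$. A sequence $A_1,\dots,A_\lambda$ of subsets of $[n]$ (repetitions allowed) is $(k_1,k_2)$-disjoint if $\bigcap_{i\in B}A_i=\emptyset$ for every $k_1$-subset $B\subseteq[\lambda]$ and $\bigcup_{i\in B}A_i=[n]$ for every $k_2$-subset $B\subseteq[\lambda]$ (each condition vacuous if the subset size exceeds $\lambda$). $m(n,t,\lambda;k_1,k_2)$ is the maximum size of a family $\mathcal{F}$ of $t$-subsets of $[n]$ such that no $A_1,\dots,A_\lambda\in\mathcal{F}$ (not necessarily distinct) form a $(k_1,k_2)$-disjoint sequence. *)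

theory Defs
  imports Complex_Main
begin

definition disjoint_seq :: "nat \<Rightarrow> nat \<Rightarrow> nat \<Rightarrow> nat \<Rightarrow> (nat \<Rightarrow> nat set) \<Rightarrow> bool" where
  "disjoint_seq n l k1 k2 A \<longleftrightarrow>
     (\<forall>i\<in>{1..l}. A i \<subseteq> {1..n}) \<and>
     (\<forall>B. B \<subseteq> {1..l} \<and> card B = k1 \<longrightarrow> (\<Inter>i\<in>B. A i) = {}) \<and>
     (\<forall>B. B \<subseteq> {1..l} \<and> card B = k2 \<longrightarrow> (\<Union>i\<in>B. A i) = {1..n})"

definition disjoint_free :: "nat \<Rightarrow> nat \<Rightarrow> nat \<Rightarrow> nat \<Rightarrow> nat set set \<Rightarrow> bool" where
  "disjoint_free n l k1 k2 F \<longleftrightarrow>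
     \<not> (\<exists>A. (\<forall>i\<in>{1..l}. A i \<in> F) \<and> disjoint_seq n l k1 k2 A)"

(* For l >= 1 the empty family is admissible, so the maximum is over a nonempty finite set. *)
definition max_disjoint_free :: "nat \<Rightarrow> nat \<Rightarrow> nat \<Rightarrow> nat \<Rightarrow> nat \<Rightarrow> nat" where
  "max_disjoint_free n t l k1 k2 =
     Max {card F | F. F \<subseteq> {S. S \<subseteq> {1..n} \<and> card S = t} \<and> disjoint_free n l k1 k2 F}"

(* Binomial coefficient with integer arguments. The value is 0 for a negative lower index,
   1 for lower index 0 (whatever the upper index), and 0 for a negative upper index
   with positive lower index (unlike gbinomial, which would give a signed value there). *)
definition int_binom :: "int \<Rightarrow> int \<Rightarrow> int" where
  "int_binom a b = (if b < 0 then 0 else int (nat a choose nat b))"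

end

(* Double counting.  If every member of F meets a set D with s1 * card D < l, then among any
   l members some point of D lies in more than s1 of them, so some s1 + 1 of them intersect.
   Dually, if every member of F misses a point of D and s2 * card D < l, then some s2 + 1
   members all miss the same point.  Taking D = {1..c - 1} with c the ceiling of l / s1
   (respectively l / s2) and the largest such F gives the two bounds. *)
theory Submission
  imports Defs
begin

text \<open>Reduces each lower bound to exhibiting one admissible family. The possible sizes form a
  finite set, so \<open>Max\<close> is a genuine upper bound for them.\<close>

lemma card_le_max_disjoint_free:
  assumes "F \<subseteq> {S. S \<subseteq> {1..n} \<and> card S = t}" "disjoint_free n l k1 k2 F"
  shows "card F \<le> max_disjoint_free n t l k1 k2"
proof -
  let ?M = "{card F | F. F \<subseteq> {S. S \<subseteq> {1..n} \<and> card S = t} \<and> disjoint_free n l k1 k2 F}"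
  have "?M \<subseteq> card ` Pow (Pow {1..n})" by blast
  then have "finite ?M" by (rule finite_subset) simp
  then show ?thesis
    unfolding max_disjoint_free_def using assms by (intro Max_ge) blast+
qed

text \<open>The fibres \<open>{i \<in> I. P i x}\<close> for \<open>x \<in> D\<close> cover
  \<open>I\<close>; if each had at most \<open>s\<close> elements, \<open>card I\<close> could not
  exceed \<open>s * card D\<close>. \<open>P\<close> is later instantiated with membership of
  \<open>x\<close> in \<open>A i\<close> and with its negation.\<close>

lemma pigeonhole_subset:
  fixes P :: "'a \<Rightarrow> 'b \<Rightarrow> bool"
  assumes "finite I" "finite D" "s * card D < card I" "\<And>i. i \<in> I \<Longrightarrow> \<exists>x\<in>D. P i x"
  obtains x B where "x \<in> D" "B \<subseteq> I" "card B = Suc s" "\<And>i. i \<in> B \<Longrightarrow> P i x"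
proof -
  have "\<exists>x\<in>D. s < card {i \<in> I. P i x}"
  proof (rule ccontr)
    assume "\<not> ?thesis"
    then have le: "card {i \<in> I. P i x} \<le> s" if "x \<in> D" for x
      using that by force
    have "I = (\<Union>x\<in>D. {i \<in> I. P i x})"
      using assms(4) by blast
    then have "card I \<le> (\<Sum>x\<in>D. card {i \<in> I. P i x})"
      using card_UN_le[OF \<open>finite D\<close>, of "\<lambda>x. {i \<in> I. P i x}"] by simp
    also have "\<dots> \<le> card D * s"
      using sum_bounded_above[OF le] by simp
    finally show False
      using assms(3) by (simp add: mult.commute)
  qed
  then obtain x where x: "x \<in> D" "Suc s \<le> card {i \<in> I. P i x}"
    by (auto simp: Suc_le_eq)
  then obtain B where "B \<subseteq> {i \<in> I. P i x}" "card B = Suc s"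
    by (meson obtain_subset_with_card_n)
  with x(1) show thesis
    by (intro that[of x B]) auto
qed

lemma disjoint_free_if_hits:
  assumes "finite D" "s1 * card D < l" "\<And>S. S \<in> F \<Longrightarrow> S \<inter> D \<noteq> {}"
  shows "disjoint_free n l (s1 + 1) k2 F"
  unfolding disjoint_free_def
proof
  assume "\<exists>A. (\<forall>i\<in>{1..l}. A i \<in> F) \<and> disjoint_seq n l (s1 + 1) k2 A"
  then obtain A where A: "\<And>i. i \<in> {1..l} \<Longrightarrow> A i \<in> F" and dj: "disjoint_seq n l (s1 + 1) k2 A"
    by blast
  have "\<exists>x\<in>D. x \<in> A i" if "i \<in> {1..l}" for i
    using assms(3)[OF A[OF that]] by blast
  then obtain x B where "x \<in> D" "B \<subseteq> {1..l}" "card B = Suc s1" "\<And>i. i \<in> B \<Longrightarrow> x \<in> A i"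
    using pigeonhole_subset[of "{1..l}" D s1 "\<lambda>i x. x \<in> A i"] assms(1,2) by auto
  moreover from this(2,3) have "(\<Inter>i\<in>B. A i) = {}"
    using dj by (simp add: disjoint_seq_def)
  ultimately show False by blast
qed

lemma disjoint_free_if_misses:
  assumes "D \<subseteq> {1..n}" "s2 * card D < l" "\<And>S. S \<in> F \<Longrightarrow> \<not> D \<subseteq> S"
  shows "disjoint_free n l k1 (s2 + 1) F"
  unfolding disjoint_free_def
proof
  assume "\<exists>A. (\<forall>i\<in>{1..l}. A i \<in> F) \<and> disjoint_seq n l k1 (s2 + 1) A"
  then obtain A where A: "\<And>i. i \<in> {1..l} \<Longrightarrow> A i \<in> F" and dj: "disjoint_seq n l k1 (s2 + 1) A"
    by blast
  have fin: "finite D"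
    using assms(1) by (rule finite_subset) simp
  have "\<exists>x\<in>D. x \<notin> A i" if "i \<in> {1..l}" for i
    using assms(3)[OF A[OF that]] by blast
  then obtain x B where x: "x \<in> D" and "B \<subseteq> {1..l}" "card B = Suc s2" "\<And>i. i \<in> B \<Longrightarrow> x \<notin> A i"
    using pigeonhole_subset[of "{1..l}" D s2 "\<lambda>i x. x \<notin> A i"] fin assms(2) by auto
  moreover from this(2,3) have "(\<Union>i\<in>B. A i) = {1..n}"
    using dj by (simp add: disjoint_seq_def)
  \<comment> \<open>The union over \<open>B\<close> omits \<open>x\<close>, although
    \<open>x\<close> lies in \<open>D\<close> and hence in \<open>{1..n}\<close>.\<close>
  ultimately show False
    using assms(1) by blast
qed

text \<open>Count the complement: a \<open>t\<close>-subset of \<open>X\<close> avoids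
  \<open>D\<close> exactly when it is a \<open>t\<close>-subset of \<open>X - D\<close>.\<close>

lemma card_subsets_hitting:
  assumes "finite X" "D \<subseteq> X"
  shows "int (card {S. S \<subseteq> X \<and> card S = t \<and> S \<inter> D \<noteq> {}})
    = int (card X choose t) - int ((card X - card D) choose t)"
proof -
  let ?all = "{S. S \<subseteq> X \<and> card S = t}" and ?bad = "{S. S \<subseteq> X - D \<and> card S = t}"
  have "{S. S \<subseteq> X \<and> card S = t \<and> S \<inter> D \<noteq> {}} = ?all - ?bad" by blast
  moreover have "?bad \<subseteq> ?all" "finite ?all" using assms by auto
  moreover have "card ?all = card X choose t" "card ?bad = (card X - card D) choose t"
    using assms by (simp_all add: n_subsets card_Diff_subset finite_subset)
  ultimately show ?thesis
    by (metis (no_types, lifting) card_Diff_subset card_mono finite_subset of_nat_diff)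
qed

text \<open>Complementation in \<open>X\<close> is its own inverse and turns "does not contain
  \<open>D\<close>" into "meets \<open>D\<close>", with size \<open>card X - t\<close> in place of
  \<open>t\<close>. This reduces the count to the previous one, and symmetry of the binomial
  coefficient restores the first term.\<close>

lemma card_subsets_missing:
  assumes "finite X" "D \<subseteq> X" "t \<le> card X"
  shows "int (card {S. S \<subseteq> X \<and> card S = t \<and> \<not> D \<subseteq> S})
    = int (card X choose t) - int ((card X - card D) choose (card X - t))"
proof -
  have "bij_betw (\<lambda>S. X - S) {S. S \<subseteq> X \<and> card S = t \<and> \<not> D \<subseteq> S}
      {S. S \<subseteq> X \<and> card S = card X - t \<and> S \<inter> D \<noteq> {}}"
  proof (rule bij_betw_byWitness[where f' = "\<lambda>S. X - S"])
    show "(\<lambda>S. X - S) ` {S. S \<subseteq> X \<and> card S = card X - t \<and> S \<inter> D \<noteq> {}}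
        \<subseteq> {S. S \<subseteq> X \<and> card S = t \<and> \<not> D \<subseteq> S}"
      using assms by (auto simp: card_Diff_subset finite_subset)
    show "(\<lambda>S. X - S) ` {S. S \<subseteq> X \<and> card S = t \<and> \<not> D \<subseteq> S}
        \<subseteq> {S. S \<subseteq> X \<and> card S = card X - t \<and> S \<inter> D \<noteq> {}}"
      using assms by (auto simp: card_Diff_subset finite_subset)
  qed auto
  then show ?thesis
    using card_subsets_hitting[OF assms(1,2), of "card X - t"] binomial_symmetric[OF assms(3)]
    by (simp add: bij_betw_same_card)
qed

text \<open>Supplies the size of \<open>D\<close>: the ceiling minus one is the largest integer
  strictly below \<open>l / s\<close>, hence the largest \<open>d\<close> that the double counting
  allows.\<close>

lemma ceiling_divide_pred:
  fixes l s :: nat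
  assumes "l \<ge> 1" "s \<ge> 1"
  obtains d where "\<lceil>real l / real s\<rceil> = int d + 1" "s * d < l"
proof -
  define d where "d = nat (\<lceil>real l / real s\<rceil> - 1)"
  \<comment> \<open>Ensures that \<open>nat\<close> does not truncate in the definition of
    \<open>d\<close>.\<close>
  have "\<lceil>real l / real s\<rceil> \<ge> 1"
    using assms by (simp add: one_le_ceiling)
  then have d: "\<lceil>real l / real s\<rceil> = int d + 1"
    by (simp add: d_def)
  then have "real d < real l / real s"
    by linarith
  then have "real (s * d) < real l"
    using assms(2) by (simp add: field_simps)
  then have "s * d < l"
    by (simp only: of_nat_less_iff)
  with d show thesis by (rule that)
qed

theorem theorem5p5:
  fixes n t l s1 s2 :: nat
  assumes "n \<ge> 1" and "t \<ge> 1" and "l \<ge> 1" and "s1 \<ge> 1" and "s2 \<ge> 1"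
    and "min (s1 + 1) (s2 + 1) \<le> l" and "l \<le> s1 + s2"
  shows "int (max_disjoint_free n t l (s1 + 1) (s2 + 1)) \<ge>
    max (int_binom (int n) (int t)
           - int_binom (int n - \<lceil>real l / real s1\<rceil> + 1) (int t))
        (int_binom (int n) (int t)
           - int_binom (int n - \<lceil>real l / real s2\<rceil> + 1) (int n - int t))"
proof (rule max.boundedI)
  let ?m = "max_disjoint_free n t l (s1 + 1) (s2 + 1)"
  \<comment> \<open>Capping d at n matches int_binom, which treats a negative upper index as 0.\<close>
  have card_D: "n - card {1..min d n} = nat (int n - (int d + 1) + 1)" for d
    by simp
  \<comment> \<open>Capping can only shrink \<open>D\<close>, so the strict bound survives.\<close>
  have small: "s * card {1..min d n} < l" if "s * d < l" for s d
    using that by (simp add: order.strict_trans1[OF mult_le_mono2[of "min d n" d s]])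
  show "int_binom (int n) (int t) - int_binom (int n - \<lceil>real l / real s1\<rceil> + 1) (int t) \<le> int ?m"
  proof -
    obtain d where c: "\<lceil>real l / real s1\<rceil> = int d + 1" and d: "s1 * d < l"
      using ceiling_divide_pred assms(3,4) by blast
    let ?D = "{1..min d n}"
    let ?F = "{S. S \<subseteq> {1..n} \<and> card S = t \<and> S \<inter> ?D \<noteq> {}}"
    have "disjoint_free n l (s1 + 1) (s2 + 1) ?F"
      by (rule disjoint_free_if_hits[OF _ small[OF d]]) auto
    then have "card ?F \<le> ?m"
      by (intro card_le_max_disjoint_free) blast+
    moreover have "int (card ?F) = int (n choose t) - int ((n - card ?D) choose t)"
      using card_subsets_hitting[of "{1..n}" ?D t] by simp
    ultimately show ?thesis
      unfolding c card_D by (simp add: int_binom_def)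
  qed
  show "int_binom (int n) (int t)
      - int_binom (int n - \<lceil>real l / real s2\<rceil> + 1) (int n - int t) \<le> int ?m"
  \<comment> \<open>The complements have size \<open>n - t\<close>, which makes sense as a natural
    number only for \<open>t \<le> n\<close>.\<close>
  proof (cases "t \<le> n")
    case True
    obtain d where c: "\<lceil>real l / real s2\<rceil> = int d + 1" and d: "s2 * d < l"
      using ceiling_divide_pred assms(3,5) by blast
    let ?D = "{1..min d n}"
    let ?F = "{S. S \<subseteq> {1..n} \<and> card S = t \<and> \<not> ?D \<subseteq> S}"
    have "disjoint_free n l (s1 + 1) (s2 + 1) ?F"
      by (rule disjoint_free_if_misses[OF _ small[OF d]]) auto
    then have "card ?F \<le> ?m"
      by (intro card_le_max_disjoint_free) blast+
    moreover have "int (card ?F) = int (n choose t) - int ((n - card ?D) choose (n - t))"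
      using card_subsets_missing[of "{1..n}" ?D t] True by simp
    moreover have "nat (int n - int t) = n - t" by simp
    ultimately show ?thesis
      unfolding c card_D using True by (simp add: int_binom_def)
  next
    case False
    \<comment> \<open>Here both terms vanish: the first since \<open>t\<close> exceeds
      \<open>n\<close>, the second since \<open>int_binom\<close> is 0 at a negative lower index.
      The claimed bound is therefore 0.\<close>
    then show ?thesis by (simp add: int_binom_def binomial_eq_0)
  qed
qed

end
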